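(* There is no $SU(2)$-invariant holographic code. That is, there is no tensor $A_{i_0;i_1\dots i_n}$, with one logical index $i_0$ (of dimension $d_0$) and $n\geq 1$ physical indices $i_1,\dots,i_n$ (each of dimension $d$), that satisfies the two holographic-code conditions (1) $A_{i_0;i_1\dots i_n}=A_{i_0;i_ni_1\dots i_{n-1}}$ (cyclic invariance in the physical indices), (2) $A$ is, up to normalization, an isometry from the logical index together with one physical index to the remaining physical indices (equivalently, the marginal of the corresponding quantum state on the logical party and that physical party is maximally mixed), and which is $SU(2)$-invariant with respect to continuous representations of $SU(2)$ on all indices, with nontrivial adjoint action on the logical index.
   Context: A holographic (Evenbly) code is a hyperinvariant tensor network on a hyperbolic tiling in which every vertex tensor $A$ carries an additional open logical leg $i_0$; its vertex tensor is in particular required to satisfy conditions (1) and (2). The quantum state corresponding to $A$ is the normalization of $|\psi_A\rangle=\sum A_{i_0;i_1\dots i_n}|i_0i_1\dots i_n\rangle\in\mathbb C^{d_0}\otimes(\mathbb C^d)^{\otimes n}$. The tensor $A$ is $SU(2)$-invariant with respect to representations $R^{(0)},\dots,R^{(n)}$ of $SU(2)$ on the index spaces if, with $R(g)=\bigotimes_{i=0}^nR^{(i)}(g)$, $R(g)|\psi_A\rangle\langle\psi_A|R(g)^\dagger=|\psi_A\rangle\langle\psi_A|$ for all $g\in SU(2)$. Nontrivial adjoint action on the logical index means that the maps $X\mapsto R^{(0)}(g)XR^{(0)}(g)^\dagger$ on $d_0\times d_0$ matrices are not all the identity. A marginal is maximally mixed if it is proportional to the identity. *)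

theory Defs
  imports "HOL-Analysis.Analysis"
begin

definition hconj :: "complex^'m^'k \<Rightarrow> complex^'k^'m" where
  "hconj M = (\<chi> i j. cnj (M $ j $ i))"

definition SU2 :: "(complex^2^2) set" where
  "SU2 = {U. hconj U ** U = mat 1 \<and> U ** hconj U = mat 1 \<and> det U = 1}"

text \<open>Representations are not required to be unitary. Invertibility of \<open>R g\<close> follows from the
  homomorphism property.\<close>

definition continuous_SU2_rep :: "(complex^2^2 \<Rightarrow> complex^'a^'a) \<Rightarrow> bool" where
  "continuous_SU2_rep R \<longleftrightarrow>
     continuous_on SU2 R \<and> R (mat 1) = mat 1 \<and> (\<forall>g\<in>SU2. \<forall>h\<in>SU2. R (g ** h) = R g ** R h)"

definition nontrivial_adjoint_action :: "(complex^2^2 \<Rightarrow> complex^'a^'a) \<Rightarrow> bool" where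
  "nontrivial_adjoint_action R \<longleftrightarrow> \<not> (\<forall>g\<in>SU2. \<forall>X. R g ** X ** hconj (R g) = X)"

text \<open>Since the number \<open>n\<close> of physical legs is a natural number and not a type, matrices on
  multi-indices are functions of a row and a column index, and products sum over an explicit
  index set.\<close>

definition kmult ::
  "'b set \<Rightarrow> ('a \<Rightarrow> 'b \<Rightarrow> complex) \<Rightarrow> ('b \<Rightarrow> 'c \<Rightarrow> complex) \<Rightarrow> 'a \<Rightarrow> 'c \<Rightarrow> complex" where
  "kmult I M N i j = (\<Sum>k\<in>I. M i k * N k j)"

definition kadj :: "('a \<Rightarrow> 'b \<Rightarrow> complex) \<Rightarrow> 'b \<Rightarrow> 'a \<Rightarrow> complex" where
  "kadj M i j = cnj (M j i)"

text \<open>A tensor \<open>A\<close> has the entry \<open>A a [x\<^sub>1, \<dots>, x\<^sub>n]\<close> at the logical index \<open>a\<close> and the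
  physical indices \<open>x\<^sub>1, \<dots>, x\<^sub>n\<close>; its values on lists of other lengths are irrelevant. The
  dimensions are \<open>d\<^sub>0 = CARD('l)\<close> and \<open>d = CARD('d)\<close>.\<close>

type_synonym ('l, 'd) tensor = "'l \<Rightarrow> 'd list \<Rightarrow> complex"

definition physical_indices :: "nat \<Rightarrow> 'd list set" where
  "physical_indices n = {xs. length xs = n}"

definition joint_indices :: "nat \<Rightarrow> ('l \<times> 'd list) set" where
  "joint_indices n = UNIV \<times> physical_indices n"

definition cyclic_invariant :: "nat \<Rightarrow> ('l, 'd) tensor \<Rightarrow> bool" where
  "cyclic_invariant n A \<longleftrightarrow>
     (\<forall>a. \<forall>xs\<in>physical_indices n. A a xs = A a (last xs # butlast xs))"

text \<open>The linear map from the logical leg and the physical leg at list position \<open>k\<close> to the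
  remaining legs; its row index \<open>ys\<close> has length \<open>n - 1\<close>.\<close>

definition leg_map :: "nat \<Rightarrow> ('l, 'd) tensor \<Rightarrow> 'd list \<Rightarrow> 'l \<times> 'd \<Rightarrow> complex" where
  "leg_map k A ys = (\<lambda>(a, x). A a (take k ys @ x # drop k ys))"

definition is_isometry :: "'b set \<Rightarrow> ('b \<Rightarrow> 'a \<Rightarrow> complex) \<Rightarrow> bool" where
  "is_isometry I V \<longleftrightarrow> (\<forall>p q. kmult I (kadj V) V p q = (if p = q then 1 else 0))"

definition isometry_up_to_normalization :: "'b set \<Rightarrow> ('b \<Rightarrow> 'a \<Rightarrow> complex) \<Rightarrow> bool" where
  "isometry_up_to_normalization I M \<longleftrightarrow>
     (\<exists>c V. c \<noteq> 0 \<and> is_isometry I V \<and> (\<forall>i\<in>I. \<forall>p. M i p = c * V i p))"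

text \<open>For a cyclically invariant tensor the isometry conditions at different positions \<open>k\<close> are
  equivalent, so requiring one of them is the same as requiring all.\<close>

definition holographic_code_tensor :: "nat \<Rightarrow> ('l::finite, 'd::finite) tensor \<Rightarrow> bool" where
  "holographic_code_tensor n A \<longleftrightarrow>
     cyclic_invariant n A \<and>
     (\<exists>k<n. isometry_up_to_normalization (physical_indices (n - 1)) (leg_map k A))"

definition tensor_state ::
  "nat \<Rightarrow> ('l::finite, 'd::finite) tensor \<Rightarrow> 'l \<times> 'd list \<Rightarrow> complex" where
  "tensor_state n A = (\<lambda>(a, xs). A a xs /
     complex_of_real (sqrt (\<Sum>(b, ys)\<in>joint_indices n. (cmod (A b ys))\<^sup>2)))"

definition projector :: "('a \<Rightarrow> complex) \<Rightarrow> 'a \<Rightarrow> 'a \<Rightarrow> complex" where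
  "projector \<psi> i j = \<psi> i * cnj (\<psi> j)"

text \<open>\<open>R0\<close> acts on the logical leg and \<open>R k\<close> on the physical leg at list position \<open>k\<close>.\<close>

definition tensor_rep ::
  "nat \<Rightarrow> (complex^2^2 \<Rightarrow> complex^'l^'l) \<Rightarrow> (nat \<Rightarrow> complex^2^2 \<Rightarrow> complex^'d^'d)
     \<Rightarrow> complex^2^2 \<Rightarrow> 'l \<times> 'd list \<Rightarrow> 'l \<times> 'd list \<Rightarrow> complex" where
  "tensor_rep n R0 R g = (\<lambda>(a, xs) (b, ys). R0 g $ a $ b * (\<Prod>k<n. R k g $ (xs ! k) $ (ys ! k)))"

definition SU2_invariant ::
  "nat \<Rightarrow> (complex^2^2 \<Rightarrow> complex^'l^'l) \<Rightarrow> (nat \<Rightarrow> complex^2^2 \<Rightarrow> complex^'d^'d)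
     \<Rightarrow> ('l::finite, 'd::finite) tensor \<Rightarrow> bool" where
  "SU2_invariant n R0 R A \<longleftrightarrow>
     (\<forall>g\<in>SU2. \<forall>i\<in>joint_indices n. \<forall>j\<in>joint_indices n.
        kmult (joint_indices n)
          (kmult (joint_indices n) (tensor_rep n R0 R g) (projector (tensor_state n A)))
          (kadj (tensor_rep n R0 R g)) i j
        = projector (tensor_state n A) i j)"

end

theory Submission
  imports Defs
begin

text \<open>Every \<open>g \<in> SU(2)\<close> lies on a periodic one-parameter subgroup \<open>cos t + J sin t\<close> with \<open>J\<^sup>2 = -1\<close>.
  Let \<open>X\<^sub>0, X\<^sub>1, \<dots>, X\<^sub>n\<close> be the generators of its representations on the legs. Invariance of the
  projector gives \<open>(X\<^sub>0 + X\<^sub>1 + \<dots> + X\<^sub>n) \<psi> = \<mu> \<psi>\<close>. By cyclicity the marginal on the logical leg and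
  any physical leg \<open>k\<close> is maximally mixed, so \<open>\<langle>Y X\<^sub>k\<rangle>\<close> is a multiple of \<open>tr Y\<close> for every logical
  operator \<open>Y\<close>. Hence \<open>tr (Y X\<^sub>0)\<close> is a multiple of \<open>tr Y\<close> as well, which forces \<open>X\<^sub>0\<close> to be a scalar;
  the period makes it imaginary. So \<open>R\<^sup>(\<^sup>0\<^sup>)(g)\<close> is a phase and acts trivially by conjugation.\<close>

section \<open>Matrix products and continuous one-parameter groups of matrices\<close>

lemma matrix_mult_scaleR_left:
  fixes A :: "complex^'b^'a" and B :: "complex^'c^'b"
  shows "(r *\<^sub>R A) ** B = r *\<^sub>R (A ** B)"
  by (simp add: matrix_matrix_mult_def vec_eq_iff scaleR_sum_right)

lemma matrix_mult_scaleR_right: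
  fixes A :: "complex^'b^'a" and B :: "complex^'c^'b"
  shows "A ** (r *\<^sub>R B) = r *\<^sub>R (A ** B)"
  by (simp add: matrix_matrix_mult_def vec_eq_iff scaleR_sum_right)

lemma matrix_add_rdistrib:
  fixes A B :: "complex^'b^'a" and C :: "complex^'c^'b"
  shows "(A + B) ** C = A ** C + B ** C"
  by (simp add: matrix_matrix_mult_def vec_eq_iff sum.distrib algebra_simps)

text \<open>Makes multiplication by a fixed matrix a bounded linear map, so that it can be moved
  through integrals and derivatives.\<close>

lemma bounded_bilinear_matrix_mult:
  "bounded_bilinear ((**) :: complex^'b^'a \<Rightarrow> complex^'c^'b \<Rightarrow> complex^'c^'a)"
  unfolding bilinear_conv_bounded_bilinear[symmetric] bilinear_def
  by (auto intro!: linearI simp: matrix_add_ldistrib matrix_add_rdistrib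
        matrix_mult_scaleR_left matrix_mult_scaleR_right)

lemma continuous_on_det: "continuous_on S (det :: complex^'a^'a \<Rightarrow> complex)"
  unfolding det_def by (intro continuous_intros)

text \<open>Integrating the functional equation over \<open>[0, h]\<close> expresses \<open>\<phi>\<close> by its antiderivative,
  up to a constant matrix that is close to \<open>h\<close> times the identity and hence invertible.\<close>

lemma continuous_one_parameter_group_differentiable:
  fixes \<phi> :: "real \<Rightarrow> complex^'a^'a"
  assumes cont: "continuous_on UNIV \<phi>" and zero: "\<phi> 0 = mat 1"
    and add: "\<And>s t. \<phi> (s + t) = \<phi> s ** \<phi> t"
  obtains X where "\<And>t. (\<phi> has_vector_derivative X ** \<phi> t) (at t)"
proof -
  interpret bounded_bilinear "(**) :: complex^'a^'a \<Rightarrow> complex^'a^'a \<Rightarrow> complex^'a^'a"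
    by (rule bounded_bilinear_matrix_mult)
  define \<Phi> where "\<Phi> u = integral {-1..u} \<phi>" for u :: real
  have cont': "continuous_on S \<phi>" for S
    using cont continuous_on_subset by blast
  have intgr: "\<phi> integrable_on {a..b}" for a b
    by (intro integrable_continuous_real cont')
  have \<Phi>: "(\<Phi> has_vector_derivative \<phi> u) (at u)" if "-1 < u" for u
    using integral_has_vector_derivative[OF cont', of u "-1" "u + 1"] that
    by (subst at_within_interior[symmetric, where S = "{-1..u + 1}"]) (auto simp: \<Phi>_def[abs_def])
  \<comment> \<open>The mean value of \<open>\<phi>\<close> between 0 and \<open>h\<close>. It tends
    to \<open>\<phi> 0\<close>, the identity, so its determinant is nonzero for small
    \<open>h\<close>.\<close>
  define M where "M h = inverse h *\<^sub>R (\<Phi> h - \<Phi> 0)" for h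
  have "M \<midarrow>0\<rightarrow> mat 1"
  proof -
    have lim: "((\<lambda>h. norm (\<Phi> h - \<Phi> 0 - h *\<^sub>R mat 1) / norm h) \<longlongrightarrow> 0) (at 0)"
      using \<Phi>[of 0] by (simp add: has_vector_derivative_def has_derivative_at zero)
    have eq: "norm (\<Phi> h - \<Phi> 0 - h *\<^sub>R mat 1) / norm h = norm (M h - mat 1)" if "h \<noteq> 0" for h
    proof -
      have "M h - mat 1 = inverse h *\<^sub>R (\<Phi> h - \<Phi> 0 - h *\<^sub>R mat 1)"
        using that by (simp add: M_def scaleR_diff_right)
      then show ?thesis
        by (simp add: divide_inverse_commute)
    qed
    from lim have "((\<lambda>h. norm (M h - mat 1)) \<longlongrightarrow> 0) (at 0)"
      by (elim Lim_transform_eventually) (auto simp: eventually_at_filter eq[simplified])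
    then show ?thesis
      by (simp add: LIM_zero_iff tendsto_norm_zero_iff)
  qed
  then have "(\<lambda>h. det (M h)) \<midarrow>0\<rightarrow> det (mat 1 :: complex^'a^'a)"
    by (rule continuous_on_tendsto_compose[OF continuous_on_det[of UNIV]]) auto
  then have "\<forall>\<^sub>F h in at 0. det (M h) \<noteq> 0"
    by (intro tendsto_imp_eventually_ne) auto
  then obtain e where e: "e > 0" "\<And>h. h \<noteq> 0 \<Longrightarrow> dist h 0 < e \<Longrightarrow> det (M h) \<noteq> 0"
    by (auto simp: eventually_at)
  define h where "h = min (e / 2) (1 / 2)"
  have h: "0 < h" "h \<le> 1 / 2" "det (M h) \<noteq> 0"
    using e(1) e(2)[of h] by (auto simp: h_def min_def dist_norm)
  obtain N where N: "M h ** N = mat 1"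
    using h(3) invertible_det_nz[of "M h"] unfolding invertible_def by blast
  have \<Phi>_diff: "integral {a..b} \<phi> = \<Phi> b - \<Phi> a" if "-1 \<le> a" "a \<le> b" for a b
    using Henstock_Kurzweil_Integration.integral_combine[OF that intgr] by (simp add: \<Phi>_def algebra_simps)
  have shift: "\<phi> t = (inverse h *\<^sub>R (\<Phi> (h + t) - \<Phi> t)) ** N" if "\<bar>t\<bar> < 1" for t
  proof -
    have "\<Phi> (h + t) - \<Phi> t = integral {t..h + t} \<phi>"
      using that h by (subst \<Phi>_diff) auto
    also have "\<dots> = integral {0..h} (\<phi> \<circ> (+) t)"
      by (simp add: integral_shift_Icc_real)
    also have "\<phi> \<circ> (+) t = (**) (\<phi> t) \<circ> \<phi>"
      by (auto simp: add)
    also have "integral {0..h} \<dots> = \<phi> t ** integral {0..h} \<phi>"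
      by (intro integral_linear intgr bounded_linear_right)
    also have "integral {0..h} \<phi> = \<Phi> h - \<Phi> 0"
      using h by (subst \<Phi>_diff) auto
    finally have "inverse h *\<^sub>R (\<Phi> (h + t) - \<Phi> t) = \<phi> t ** M h"
      by (simp add: M_def matrix_mult_scaleR_right)
    then show ?thesis
      using N by (simp add: matrix_mul_assoc[symmetric])
  qed
  \<comment> \<open>Since \<open>\<Phi>\<close> has derivative \<open>\<phi>\<close>, this is the
    derivative at 0 of the right-hand side in \<open>shift\<close>.\<close>
  define X where "X = (inverse h *\<^sub>R (\<phi> h - \<phi> 0)) ** N"
  have "((\<lambda>t. (inverse h *\<^sub>R (\<Phi> (h + t) - \<Phi> t)) ** N) has_vector_derivative X) (at 0)"
  proof -
    have "((+) h has_vector_derivative 1) (at 0)"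
      by (auto intro!: derivative_eq_intros)
    then have "((\<lambda>t. \<Phi> (h + t)) has_vector_derivative \<phi> h) (at 0)"
      using vector_diff_chain_at[of "(+) h" 1 0 \<Phi> "\<phi> h"] \<Phi>[of h] h
      by (simp add: o_def)
    from has_vector_derivative_diff[OF this \<Phi>[of 0]] show ?thesis
      unfolding X_def
      by (intro bounded_linear.has_vector_derivative[OF bounded_linear_left]
          bounded_linear.has_vector_derivative[OF bounded_linear_scaleR_right]) simp_all
  qed
  then have X: "(\<phi> has_vector_derivative X) (at 0)"
    by (rule has_vector_derivative_transform_within_open[where S = "ball 0 1"])
       (auto simp: shift)
  \<comment> \<open>The derivative at 0 is carried to \<open>t\<close> by the group law, with
    \<open>\<phi> s\<close> written as \<open>\<phi> (s - t) ** \<phi> t\<close>.\<close>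
  have "(\<phi> has_vector_derivative X ** \<phi> t) (at t)" for t
  proof -
    have "((\<lambda>s. s - t) has_vector_derivative 1) (at t)"
      by (auto intro!: derivative_eq_intros)
    then have "((\<lambda>s. \<phi> (s - t)) has_vector_derivative X) (at t)"
      using vector_diff_chain_at[of "\<lambda>s. s - t" 1 t \<phi> X] X
      by (simp add: o_def)
    then have "((\<lambda>s. \<phi> (s - t) ** \<phi> t) has_vector_derivative X ** \<phi> t) (at t)"
      by (rule bounded_linear.has_vector_derivative[OF bounded_linear_left])
    then show ?thesis
      by (simp add: add[symmetric])
  qed
  then show thesis by (rule that)
qed

section \<open>Periodic one-parameter subgroups of SU(2)\<close>

text \<open>When \<open>J\<close> squares to minus the identity, this is the matrix exponential of
  \<open>t\<close> times \<open>J\<close>, in the form of Euler's formula.\<close>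

definition su2_curve :: "complex^2^2 \<Rightarrow> real \<Rightarrow> complex^2^2" where
  "su2_curve J t = cos t *\<^sub>R mat 1 + sin t *\<^sub>R J"

lemma su2_curve_0 [simp]: "su2_curve J 0 = mat 1"
  by (simp add: su2_curve_def)

lemma su2_curve_2pi [simp]: "su2_curve J (2 * pi) = mat 1"
  by (simp add: su2_curve_def)

lemma continuous_on_su2_curve: "continuous_on S (su2_curve J)"
  unfolding su2_curve_def[abs_def] by (intro continuous_intros)

lemma su2_curve_add:
  assumes "J ** J = - mat 1"
  shows "su2_curve J (s + t) = su2_curve J s ** su2_curve J t"
  by (simp add: su2_curve_def matrix_add_ldistrib matrix_add_rdistrib matrix_mult_scaleR_left
      matrix_mult_scaleR_right assms cos_add sin_add algebra_simps)

text \<open>SU(2) is the group of unit quaternions: each has the form cos + J sin, where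
  \<open>J\<close> is the unit vector along its imaginary part.\<close>

lemma SU2_imp_su2_curve:
  assumes "U \<in> SU2"
  obtains J t where "J ** J = - mat 1" "range (su2_curve J) \<subseteq> SU2" "U = su2_curve J t"
proof -
  define a b c d where abcd: "a = U $ 1 $ 1" "b = U $ 1 $ 2" "c = U $ 2 $ 1" "d = U $ 2 $ 2"
  have det: "a * d - b * c = 1"
    using assms by (simp add: SU2_def det_2 abcd)
  have "U ** hconj U = mat 1"
    using assms by (simp add: SU2_def)
  then have 1: "a * cnj a + b * cnj b = 1" and 2: "c * cnj a + d * cnj b = 0"
    by (auto simp: hconj_def matrix_matrix_mult_def vec_eq_iff forall_2 sum_2 mat_def abcd)
  \<comment> \<open>Multiply \<open>1\<close> by \<open>d\<close> (below, by \<open>c\<close>), then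
    use the orthogonality of the rows and the determinant.\<close>
  have d: "d = cnj a"
    using det 1 2 by algebra
  have c: "c = - cnj b"
    using det 1 2 by algebra
  define \<theta> where "\<theta> = arccos (Re a)"
  have nrm: "(Re a)\<^sup>2 + (Im a)\<^sup>2 + (Re b)\<^sup>2 + (Im b)\<^sup>2 = 1"
    using arg_cong[OF 1, of Re] by (simp add: power2_eq_square)
  have "(Re a)\<^sup>2 \<le> 1"
    using nrm zero_le_power2[of "Im a"] zero_le_power2[of "Re b"] zero_le_power2[of "Im b"] by linarith
  then have "\<bar>Re a\<bar> \<le> 1"
    by (simp add: abs_square_le_1)
  then have cos: "cos \<theta> = Re a"
    by (simp add: \<theta>_def cos_arccos_abs)
  have sin: "(sin \<theta>)\<^sup>2 = (Im a)\<^sup>2 + (Re b)\<^sup>2 + (Im b)\<^sup>2"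
    using nrm by (simp add: sin_squared_eq cos)
  \<comment> \<open>The direction of the imaginary part. If \<open>sin \<theta>\<close> vanishes,
    \<open>U\<close> is plus or minus the identity and any unit direction serves;
    \<open>p = 1\<close>, \<open>q = 0\<close> is taken.\<close>
  obtain p :: real and q :: complex where pq: "Im a = sin \<theta> * p" "b = sin \<theta> * q"
    "p\<^sup>2 + (Re q)\<^sup>2 + (Im q)\<^sup>2 = 1"
  proof (cases "sin \<theta> = 0")
    case True
    then have "Im a = 0" "b = 0"
      using sin by (auto simp: complex_eq_iff add_nonneg_eq_0_iff)
    then show ?thesis
      using that[of 1 0] True by simp
  next
    case False
    then have "(Im a / sin \<theta>)\<^sup>2 + (Re (b / sin \<theta>))\<^sup>2 + (Im (b / sin \<theta>))\<^sup>2 = 1"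
      by (simp add: power_divide add_divide_distrib[symmetric] sin[symmetric])
    with False show ?thesis
      by (intro that[of "Im a / sin \<theta>" "b / sin \<theta>"]) auto
  qed
  define J :: "complex^2^2" where
    "J = vector [vector [\<i> * p, q], vector [- cnj q, - \<i> * p]]"
  have pq': "q * cnj q = 1 - of_real (p\<^sup>2)"
    using pq(3) by (simp add: complex_eq_iff power2_eq_square algebra_simps)
  have JJ: "J ** J = - mat 1"
    using pq'
    by (simp add: J_def matrix_matrix_mult_def vec_eq_iff forall_2 sum_2 mat_def algebra_simps power2_eq_square)
  \<comment> \<open>\<open>J\<close> is anti-Hermitian, so the adjoint reverses the parameter;
    unitarity then follows from the group law.\<close>
  have "hconj (su2_curve J t) = su2_curve J (- t)" for t
    by (simp add: su2_curve_def J_def hconj_def vec_eq_iff forall_2 mat_def)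
  then have unit: "hconj (su2_curve J t) ** su2_curve J t = mat 1"
    "su2_curve J t ** hconj (su2_curve J t) = mat 1" for t
    using su2_curve_add[OF JJ, of "-t" t] su2_curve_add[OF JJ, of t "-t"] by simp_all
  have "det (su2_curve J t) = 1" for t
  proof -
    have "det (su2_curve J t) = of_real ((cos t)\<^sup>2) + of_real ((sin t)\<^sup>2) * (of_real (p\<^sup>2) + q * cnj q)"
      unfolding det_2 su2_curve_def J_def
      by (simp add: mat_def) (simp add: scaleR_conv_of_real algebra_simps power2_eq_square)
    moreover have "of_real ((cos t)\<^sup>2) + of_real ((sin t)\<^sup>2) = (1 :: complex)"
      by (simp only: of_real_add[symmetric] sin_cos_squared_add2 of_real_1)
    ultimately show ?thesis
      unfolding pq' by simp
  qed
  with unit have "range (su2_curve J) \<subseteq> SU2"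
    by (auto simp: SU2_def)
  moreover have "U = su2_curve J \<theta>"
    using pq cos d c
    by (simp add: vec_eq_iff forall_2 su2_curve_def J_def mat_def abcd[symmetric] complex_eq_iff)
  ultimately show thesis
    using that JJ by blast
qed


section \<open>Cyclic tensors and their marginals\<close>

lemma finite_physical_indices: "finite (physical_indices n :: 'd::finite list set)"
  using finite_lists_length_eq[of "UNIV :: 'd set" n] by (simp add: physical_indices_def)

lemma finite_joint_indices: "finite (joint_indices n :: ('l::finite \<times> 'd::finite list) set)"
  by (simp add: joint_indices_def finite_physical_indices)

text \<open>The cyclicity condition moves the last entry to the front. Applied to a list already
  rotated by one place, it undoes that rotation.\<close>

lemma cyclic_invariant_rotate:
  assumes "cyclic_invariant n A" "length xs = n"
  shows "A a (rotate k xs) = A a xs"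
proof (induction k)
  case (Suc k)
  let ?ys = "rotate k xs"
  have "A a (rotate1 ?ys) = A a (last (rotate1 ?ys) # butlast (rotate1 ?ys))"
    using assms by (simp add: cyclic_invariant_def physical_indices_def)
  also have "\<dots> = A a ?ys" if "?ys \<noteq> []"
    using that by (cases ?ys) auto
  finally have "A a (rotate1 ?ys) = A a ?ys"
    by (cases "?ys = []") (metis rotate1.simps(1), blast)
  then show ?case
    using Suc by simp
qed simp

text \<open>Rotating the full index by \<open>k\<close> brings the inserted leg to the front and
  leaves the other legs rotated by \<open>k\<close>.\<close>

lemma leg_map_rotate:
  assumes "cyclic_invariant n A" "length ys = n - 1" "k < n"
  shows "leg_map k A ys = leg_map 0 A (rotate k ys)"
proof -
  have "A a (take k ys @ x # drop k ys) = A a (x # rotate k ys)" for a x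
  proof -
    have k: "k \<le> length ys"
      using assms by simp
    have "rotate k (take k ys @ x # drop k ys) = x # drop k ys @ take k ys"
      using rotate_append[of "take k ys" "x # drop k ys"] k by simp
    moreover have "rotate k ys = drop k ys @ take k ys"
      using rotate_append[of "take k ys" "drop k ys"] k by simp
    moreover have "A a (rotate k (take k ys @ x # drop k ys)) = A a (take k ys @ x # drop k ys)"
      using assms by (intro cyclic_invariant_rotate) auto
    ultimately show ?thesis
      by simp
  qed
  then show ?thesis
    by (auto simp: leg_map_def fun_eq_iff)
qed

lemma bij_betw_rotate_physical_indices:
  "bij_betw (rotate k) (physical_indices m) (physical_indices m :: 'd::finite list set)"
proof -
  have "inj_on (rotate k) (physical_indices m :: 'd list set)"
    unfolding rotate_def by (intro inj_on_subset[OF inj_fn[OF inj_rotate1]] subset_UNIV)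
  moreover have "rotate k ` physical_indices m \<subseteq> (physical_indices m :: 'd list set)"
    by (auto simp: physical_indices_def)
  ultimately show ?thesis
    by (simp add: bij_betw_def endo_inj_surj[OF finite_physical_indices])
qed

text \<open>The isometry condition is given at one position only. Rotation merely permutes the
  remaining indices, so every position has the same Gram matrix as position 0, and
  \<open>\<kappa>\<close> is the squared modulus of the normalization constant.\<close>

lemma holographic_code_tensor_leg_orthogonality:
  fixes A :: "('l::finite, 'd::finite) tensor"
  assumes "holographic_code_tensor n A"
  obtains \<kappa> where "\<kappa> \<noteq> 0"
    "\<And>k p q. k < n \<Longrightarrow>
      (\<Sum>ys\<in>physical_indices (n - 1). cnj (leg_map k A ys p) * leg_map k A ys q) = (if p = q then \<kappa> else 0)"
proof -
  have cyc: "cyclic_invariant n A"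
    using assms by (simp add: holographic_code_tensor_def)
  obtain m c V where m: "m < n" and c: "c \<noteq> 0" and iso: "is_isometry (physical_indices (n - 1)) V"
    and cV: "\<And>ys p. ys \<in> physical_indices (n - 1) \<Longrightarrow> leg_map m A ys p = c * V ys p"
    using assms unfolding holographic_code_tensor_def isometry_up_to_normalization_def by blast
  have "(\<Sum>ys\<in>physical_indices (n - 1). cnj (leg_map k A ys p) * leg_map k A ys q)
      = (if p = q then cnj c * c else 0)" if k: "k < n" for k p q
  proof -
    have to_0: "(\<Sum>ys\<in>physical_indices (n - 1). cnj (leg_map l A ys p) * leg_map l A ys q)
      = (\<Sum>ys\<in>physical_indices (n - 1). cnj (leg_map 0 A ys p) * leg_map 0 A ys q)" if "l < n" for l
    proof -
      have "(\<Sum>ys\<in>physical_indices (n - 1). cnj (leg_map l A ys p) * leg_map l A ys q)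
        = (\<Sum>ys\<in>physical_indices (n - 1). cnj (leg_map 0 A (rotate l ys) p) * leg_map 0 A (rotate l ys) q)"
        by (intro sum.cong) (auto simp: leg_map_rotate[OF cyc _ that] physical_indices_def)
      also have "\<dots> = (\<Sum>ys\<in>physical_indices (n - 1). cnj (leg_map 0 A ys p) * leg_map 0 A ys q)"
        by (rule sum.reindex_bij_betw[OF bij_betw_rotate_physical_indices])
      finally show ?thesis .
    qed
    have "(\<Sum>ys\<in>physical_indices (n - 1). cnj (leg_map m A ys p) * leg_map m A ys q)
      = cnj c * c * (\<Sum>ys\<in>physical_indices (n - 1). cnj (V ys p) * V ys q)"
      by (simp add: cV sum_distrib_left mult_ac)
    also have "(\<Sum>ys\<in>physical_indices (n - 1). cnj (V ys p) * V ys q) = (if p = q then 1 else 0)"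
      using iso unfolding is_isometry_def kmult_def kadj_def by blast
    finally show ?thesis
      using to_0[OF k] to_0[OF m] by (simp split: if_splits)
  qed
  with c show thesis
    by (intro that[of "cnj c * c"]) auto
qed

lemma sum_physical_indices_insert_leg:
  assumes "k < n"
  shows "(\<Sum>xs\<in>physical_indices n. f xs)
    = (\<Sum>ys\<in>physical_indices (n - 1). \<Sum>x\<in>(UNIV :: 'd::finite set). f (take k ys @ x # drop k ys))"
proof -
  have "(\<Sum>xs\<in>physical_indices n. f xs)
    = (\<Sum>(ys, x)\<in>physical_indices (n - 1) \<times> (UNIV :: 'd set). f (take k ys @ x # drop k ys))"
    using assms
    by (intro sum.reindex_bij_witness[where i = "\<lambda>(ys, x). take k ys @ x # drop k ys"
          and j = "\<lambda>xs. (take k xs @ drop (Suc k) xs, xs ! k)"])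
       (auto simp: physical_indices_def id_take_nth_drop[symmetric] nth_append min_def)
  then show ?thesis
    by (simp add: sum.cartesian_product)
qed

section \<open>Differentiating the invariance, and the generator on the logical leg\<close>

text \<open>A vector with constant projector moves only by a phase. Differentiating a column of the
  projector at an index \<open>j\<close> with \<open>\<psi> j\<close> nonzero and dividing by the
  conjugate of \<open>\<psi> j\<close> gives the factor \<open>\<mu>\<close>.\<close>

lemma projector_eq_imp_derivative_proportional:
  fixes F :: "real \<Rightarrow> 'i \<Rightarrow> complex"
  assumes proj: "\<And>t i j. i \<in> I \<Longrightarrow> j \<in> I \<Longrightarrow> projector (F t) i j = projector \<psi> i j"
    and F0: "\<And>i. i \<in> I \<Longrightarrow> F 0 i = \<psi> i"
    and F': "\<And>i. i \<in> I \<Longrightarrow> ((\<lambda>t. F t i) has_vector_derivative F' i) (at 0)"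
  obtains \<mu> where "\<And>i. i \<in> I \<Longrightarrow> F' i = \<mu> * \<psi> i"
proof (cases "\<exists>j\<in>I. \<psi> j \<noteq> 0")
  case True
  then obtain j where j: "j \<in> I" "\<psi> j \<noteq> 0" by blast
  have "F' i = - cnj (F' j) / cnj (\<psi> j) * \<psi> i" if i: "i \<in> I" for i
  proof -
    have "((\<lambda>t. F t i * cnj (F t j)) has_vector_derivative F 0 i * cnj (F' j) + F' i * cnj (F 0 j)) (at 0)"
      by (intro has_vector_derivative_mult F' i j has_vector_derivative_cnj)
    moreover have "(\<lambda>t. F t i * cnj (F t j)) = (\<lambda>t. \<psi> i * cnj (\<psi> j))"
      using proj[OF i j(1)] by (simp add: projector_def)
    ultimately have "\<psi> i * cnj (F' j) + F' i * cnj (\<psi> j) = 0"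
      using F0 i j(1) vector_derivative_unique_at[OF _ has_vector_derivative_const] by simp
    then show ?thesis
      using j by (simp add: field_simps eq_neg_iff_add_eq_0)
  qed
  then show ?thesis by (rule that)
next
  case False
  have "F' i = 0" if i: "i \<in> I" for i
  proof -
    \<comment> \<open>The diagonal entry of the projector is the squared modulus of
      \<open>F t i\<close>, and here \<open>\<psi>\<close> vanishes on \<open>I\<close>.\<close>
    have "(\<lambda>t. F t i) = (\<lambda>t. 0)"
      using proj[OF i i] False i by (auto simp: projector_def)
    then show ?thesis
      using F'[OF i] vector_derivative_unique_at[OF _ has_vector_derivative_const] by metis
  qed
  then show ?thesis
    using that[of 0] by simp
qed

lemma has_vector_derivative_matrix_component:
  fixes f :: "real \<Rightarrow> complex^'b^'a"
  assumes "(f has_vector_derivative f') F"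
  shows "((\<lambda>t. f t $ i $ j) has_vector_derivative f' $ i $ j) F"
  by (intro bounded_linear.has_vector_derivative[OF bounded_linear_vec_nth] assms)

lemma has_vector_derivative_prod:
  fixes f :: "'i \<Rightarrow> real \<Rightarrow> complex"
  assumes "\<And>i. i \<in> I \<Longrightarrow> (f i has_vector_derivative f' i) (at t)"
  shows "((\<lambda>s. \<Prod>i\<in>I. f i s) has_vector_derivative (\<Sum>i\<in>I. f' i * (\<Prod>j\<in>I - {i}. f j t))) (at t)"
  using has_derivative_prod[of I f "\<lambda>i s. s *\<^sub>R f' i" t UNIV] assms
  by (simp add: has_vector_derivative_def scaleR_sum_right)

lemma prod_mat_1_entries:
  assumes "xs \<in> physical_indices n" "ys \<in> physical_indices n"
  shows "(\<Prod>k<n. (mat 1 :: complex^'d^'d) $ (xs ! k) $ (ys ! k)) = (if ys = xs then 1 else 0)"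
proof -
  have "(\<Prod>k<n. (mat 1 :: complex^'d^'d) $ (xs ! k) $ (ys ! k)) = (if \<forall>k<n. xs ! k = ys ! k then 1 else 0)"
    by (auto simp: mat_def)
  also have "(\<forall>k<n. xs ! k = ys ! k) \<longleftrightarrow> ys = xs"
    using assms by (auto simp: physical_indices_def list_eq_iff_nth_eq)
  finally show ?thesis .
qed

lemma tensor_rep_identity:
  fixes R0 :: "complex^2^2 \<Rightarrow> complex^'a^'a" and R :: "nat \<Rightarrow> complex^2^2 \<Rightarrow> complex^'b^'b"
  assumes "R0 g = mat 1" "\<And>k. k < n \<Longrightarrow> R k g = mat 1" "i \<in> joint_indices n" "j \<in> joint_indices n"
  shows "tensor_rep n R0 R g i j = (if j = i then 1 else 0)"
proof -
  obtain a xs b ys where ij: "i = (a, xs)" "j = (b, ys)"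
    by fastforce
  have "(\<Prod>k<n. R k g $ (xs ! k) $ (ys ! k)) = (\<Prod>k<n. (mat 1 :: complex^'b^'b) $ (xs ! k) $ (ys ! k))"
    using assms(2) by simp
  also have "\<dots> = (if ys = xs then 1 else 0)"
    using assms(3,4) by (intro prod_mat_1_entries) (auto simp: ij joint_indices_def)
  finally show ?thesis
    using assms(1) by (simp add: ij tensor_rep_def) (simp add: mat_def)
qed

text \<open>The Leibniz rule at the identity: in each term one leg carries its generator and all
  other legs carry identity matrices.\<close>

lemma has_vector_derivative_tensor_rep:
  fixes R0 :: "complex^2^2 \<Rightarrow> complex^'l^'l" and R :: "nat \<Rightarrow> complex^2^2 \<Rightarrow> complex^'d^'d"
  assumes R0: "((\<lambda>t. R0 (\<gamma> t)) has_vector_derivative X0) (at 0)" "R0 (\<gamma> 0) = mat 1"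
    and R: "\<And>k. k < n \<Longrightarrow> ((\<lambda>t. R k (\<gamma> t)) has_vector_derivative X k) (at 0)"
      "\<And>k. k < n \<Longrightarrow> R k (\<gamma> 0) = mat 1"
    and xs: "xs \<in> physical_indices n"
  shows "((\<lambda>t. \<Sum>j\<in>joint_indices n. tensor_rep n R0 R (\<gamma> t) (a, xs) j * \<psi> j) has_vector_derivative
    (\<Sum>b\<in>UNIV. X0 $ a $ b * \<psi> (b, xs)) +
    (\<Sum>k<n. \<Sum>y\<in>UNIV. X k $ (xs ! k) $ y * \<psi> (a, xs[k := y]))) (at 0)"
proof -
  have len: "length xs = n"
    using xs by (simp add: physical_indices_def)
  define T' where "T' b ys = R0 (\<gamma> 0) $ a $ b *
      (\<Sum>k<n. X k $ (xs ! k) $ (ys ! k) * (\<Prod>l\<in>{..<n} - {k}. R l (\<gamma> 0) $ (xs ! l) $ (ys ! l)))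
    + X0 $ a $ b * (\<Prod>k<n. R k (\<gamma> 0) $ (xs ! k) $ (ys ! k))" for b ys
  have "((\<lambda>t. tensor_rep n R0 R (\<gamma> t) (a, xs) (b, ys)) has_vector_derivative T' b ys) (at 0)" for b ys
    unfolding tensor_rep_def T'_def prod.case
    by (intro has_vector_derivative_mult has_vector_derivative_prod
        has_vector_derivative_matrix_component R0 R) auto
  then have "((\<lambda>t. \<Sum>j\<in>joint_indices n. tensor_rep n R0 R (\<gamma> t) (a, xs) j * \<psi> j) has_vector_derivative
    (\<Sum>j\<in>joint_indices n. T' (fst j) (snd j) * \<psi> j)) (at 0)"
    by (intro has_vector_derivative_sum has_vector_derivative_mult_left) (metis prod.collapse)
  moreover have "(\<Sum>j\<in>joint_indices n. T' (fst j) (snd j) * \<psi> j) =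
    (\<Sum>b\<in>UNIV. X0 $ a $ b * \<psi> (b, xs)) +
    (\<Sum>k<n. \<Sum>y\<in>UNIV. X k $ (xs ! k) $ y * \<psi> (a, xs[k := y]))"
  proof -
    \<comment> \<open>The undifferentiated factors are identity matrices at parameter 0, so only
      indices that agree with \<open>xs\<close> away from leg \<open>k\<close> survive.\<close>
    have prod2: "(\<Prod>l\<in>{..<n} - {k}. R l (\<gamma> 0) $ (xs ! l) $ (ys ! l)) = (if ys = xs[k := ys ! k] then 1 else 0)"
      if "ys \<in> physical_indices n" "k < n" for ys k
    proof -
      have "(\<Prod>l\<in>{..<n} - {k}. R l (\<gamma> 0) $ (xs ! l) $ (ys ! l)) = (\<Prod>l\<in>{..<n} - {k}. if xs ! l = ys ! l then 1 else 0)"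
        by (intro prod.cong) (auto simp: R(2) mat_def)
      also have "\<dots> = (if \<forall>l<n. l \<noteq> k \<longrightarrow> xs ! l = ys ! l then 1 else 0)"
        by auto
      also have "(\<forall>l<n. l \<noteq> k \<longrightarrow> xs ! l = ys ! l) \<longleftrightarrow> ys = xs[k := ys ! k]"
        using that len by (auto simp: physical_indices_def list_eq_iff_nth_eq nth_list_update)
      finally show ?thesis .
    qed
    have part1: "(\<Sum>b\<in>UNIV. \<Sum>ys\<in>physical_indices n.
        X0 $ a $ b * (\<Prod>k<n. R k (\<gamma> 0) $ (xs ! k) $ (ys ! k)) * \<psi> (b, ys))
      = (\<Sum>b\<in>UNIV. X0 $ a $ b * \<psi> (b, xs))"
      using xs by (intro sum.cong refl) (simp add: R(2) prod_mat_1_entries if_distrib if_distribR finite_physical_indices cong: if_cong)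
    have sum_leg: "(\<Sum>ys\<in>physical_indices n. X k $ (xs ! k) $ (ys ! k) *
          (\<Prod>l\<in>{..<n} - {k}. R l (\<gamma> 0) $ (xs ! l) $ (ys ! l)) * \<psi> (a, ys))
        = (\<Sum>y\<in>UNIV. X k $ (xs ! k) $ y * \<psi> (a, xs[k := y]))" if "k < n" for k
    proof -
      have "(\<Sum>ys\<in>physical_indices n. X k $ (xs ! k) $ (ys ! k) *
          (\<Prod>l\<in>{..<n} - {k}. R l (\<gamma> 0) $ (xs ! l) $ (ys ! l)) * \<psi> (a, ys))
        = (\<Sum>ys\<in>{ys \<in> physical_indices n. ys = xs[k := ys ! k]}. X k $ (xs ! k) $ (ys ! k) * \<psi> (a, ys))"
        by (intro sum.mono_neutral_cong_right) (auto simp: prod2 that finite_physical_indices)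
      also have "\<dots> = (\<Sum>y\<in>UNIV. X k $ (xs ! k) $ y * \<psi> (a, xs[k := y]))"
        using that len
        by (intro sum.reindex_bij_witness[where i = "\<lambda>y. xs[k := y]" and j = "\<lambda>ys. ys ! k"])
           (auto simp: physical_indices_def)
      finally show ?thesis .
    qed
    have "(\<Sum>b\<in>UNIV. \<Sum>ys\<in>physical_indices n. R0 (\<gamma> 0) $ a $ b *
        (\<Sum>k<n. X k $ (xs ! k) $ (ys ! k) * (\<Prod>l\<in>{..<n} - {k}. R l (\<gamma> 0) $ (xs ! l) $ (ys ! l))) * \<psi> (b, ys))
      = (\<Sum>b\<in>UNIV. if b = a then \<Sum>ys\<in>physical_indices n.
        (\<Sum>k<n. X k $ (xs ! k) $ (ys ! k) * (\<Prod>l\<in>{..<n} - {k}. R l (\<gamma> 0) $ (xs ! l) $ (ys ! l))) * \<psi> (a, ys) else 0)"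
      by (intro sum.cong refl) (auto simp: R0(2) mat_def)
    also have "\<dots> = (\<Sum>ys\<in>physical_indices n. \<Sum>k<n. X k $ (xs ! k) $ (ys ! k) *
          (\<Prod>l\<in>{..<n} - {k}. R l (\<gamma> 0) $ (xs ! l) $ (ys ! l)) * \<psi> (a, ys))"
      by (simp add: sum_distrib_right)
    also have "\<dots> = (\<Sum>k<n. \<Sum>y\<in>UNIV. X k $ (xs ! k) $ y * \<psi> (a, xs[k := y]))"
      by (subst sum.swap) (simp add: sum_leg)
    finally show ?thesis
      using part1
      by (simp add: T'_def joint_indices_def sum.cartesian_product' distrib_right sum.distrib add.commute)
  qed
  ultimately show ?thesis by simp
qed

text \<open>Pairing the eigenvector equation with \<open>A\<close> at the logical index \<open>a'\<close> turns every physical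
  generator into its trace, because the marginals on the logical and one physical leg are
  maximally mixed.\<close>

lemma logical_generator_scalar:
  fixes A :: "('l::finite, 'd::finite) tensor" and X0 :: "complex^'l^'l"
    and X :: "nat \<Rightarrow> complex^'d^'d"
  assumes code: "holographic_code_tensor n A" and n: "n \<ge> 1"
    and eig: "\<And>a xs. xs \<in> physical_indices n \<Longrightarrow>
      (\<Sum>b\<in>UNIV. X0 $ a $ b * A b xs) + (\<Sum>k<n. \<Sum>y\<in>UNIV. X k $ (xs ! k) $ y * A a (xs[k := y])) = \<mu> * A a xs"
  obtains c where "\<And>a b. X0 $ a $ b = (if a = b then c else 0)"
proof -
  obtain \<kappa> where \<kappa>: "\<kappa> \<noteq> 0"
    "\<And>k p q. k < n \<Longrightarrow>
      (\<Sum>ys\<in>physical_indices (n - 1). cnj (leg_map k A ys p) * leg_map k A ys q) = (if p = q then \<kappa> else 0)"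
    using holographic_code_tensor_leg_orthogonality[OF code] by blast
  \<comment> \<open>The squared norm of each logical slice of \<open>A\<close>: every value of one
    physical index contributes \<open>\<kappa>\<close>. By \<open>gram\<close>, distinct slices are
    orthogonal.\<close>
  define D where "D = of_nat CARD('d) * \<kappa>"
  have D: "D \<noteq> 0"
    using \<kappa> by (simp add: D_def)
  have gram: "(\<Sum>xs\<in>physical_indices n. cnj (A a' xs) * A b xs) = (if b = a' then D else 0)" for a' b
  proof -
    have "(\<Sum>xs\<in>physical_indices n. cnj (A a' xs) * A b xs)
      = (\<Sum>x\<in>UNIV. \<Sum>ys\<in>physical_indices (n - 1). cnj (leg_map 0 A ys (a', x)) * leg_map 0 A ys (b, x))"
      using n by (subst sum_physical_indices_insert_leg[of 0], simp) (subst sum.swap, simp add: leg_map_def)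
    also have "\<dots> = (if b = a' then D else 0)"
      using n by (subst \<kappa>(2)) (auto simp: D_def)
    finally show ?thesis .
  qed
  define \<tau> where "\<tau> = (\<Sum>k<n. \<Sum>x\<in>UNIV. X k $ x $ x)"
  \<comment> \<open>Split off leg \<open>k\<close>. The Gram matrix of \<open>leg_map k A\<close> is
    \<open>\<kappa>\<close> times the identity, so only the diagonal of \<open>X k\<close> and equal
    logical indices remain.\<close>
  have leg: "(\<Sum>xs\<in>physical_indices n. cnj (A a' xs) * (\<Sum>y\<in>UNIV. X k $ (xs ! k) $ y * A a (xs[k := y])))
      = (if a = a' then \<kappa> * (\<Sum>x\<in>UNIV. X k $ x $ x) else 0)" if k: "k < n" for k a a'
  proof -
    have "(\<Sum>xs\<in>physical_indices n. cnj (A a' xs) * (\<Sum>y\<in>UNIV. X k $ (xs ! k) $ y * A a (xs[k := y])))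
      = (\<Sum>ys\<in>physical_indices (n - 1). \<Sum>x\<in>UNIV. \<Sum>y\<in>UNIV.
          X k $ x $ y * (cnj (leg_map k A ys (a', x)) * leg_map k A ys (a, y)))"
      using k
      by (subst sum_physical_indices_insert_leg[OF k])
         (auto intro!: sum.cong simp: leg_map_def physical_indices_def nth_append
           list_update_append sum_distrib_left mult_ac)
    also have "\<dots> = (\<Sum>x\<in>UNIV. \<Sum>y\<in>UNIV. X k $ x $ y *
        (\<Sum>ys\<in>physical_indices (n - 1). cnj (leg_map k A ys (a', x)) * leg_map k A ys (a, y)))"
      by (subst sum.swap, intro sum.cong refl, subst sum.swap) (simp add: sum_distrib_left)
    also have "\<dots> = (\<Sum>x\<in>UNIV. \<Sum>y\<in>UNIV. if y = x then (if a = a' then X k $ x $ x * \<kappa> else 0) else 0)"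
      unfolding \<kappa>(2)[OF k] by (intro sum.cong refl) auto
    also have "\<dots> = (if a = a' then \<kappa> * (\<Sum>x\<in>UNIV. X k $ x $ x) else 0)"
      by (simp add: sum_distrib_left mult.commute)
    finally show ?thesis .
  qed
  \<comment> \<open>Pair \<open>eig\<close> with the slice at \<open>a'\<close>: every term other
    than that of \<open>X0\<close> is diagonal in the logical indices, and \<open>D\<close> can be
    divided out.\<close>
  have "X0 $ a $ a' = (if a = a' then \<mu> - \<kappa> * \<tau> / D else 0)" for a a'
  proof -
    have "(\<Sum>xs\<in>physical_indices n. cnj (A a' xs) * (\<Sum>b\<in>UNIV. X0 $ a $ b * A b xs))
      = (\<Sum>b\<in>UNIV. X0 $ a $ b * (\<Sum>xs\<in>physical_indices n. cnj (A a' xs) * A b xs))"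
      by (simp add: sum_distrib_left mult_ac) (rule sum.swap)
    also have "\<dots> = X0 $ a $ a' * D"
      by (simp add: gram if_distrib cong: if_cong)
    finally have 1: "(\<Sum>xs\<in>physical_indices n. cnj (A a' xs) * (\<Sum>b\<in>UNIV. X0 $ a $ b * A b xs)) = X0 $ a $ a' * D" .
    have "(\<Sum>xs\<in>physical_indices n. cnj (A a' xs) * (\<Sum>k<n. \<Sum>y\<in>UNIV. X k $ (xs ! k) $ y * A a (xs[k := y])))
      = (\<Sum>k<n. \<Sum>xs\<in>physical_indices n. cnj (A a' xs) * (\<Sum>y\<in>UNIV. X k $ (xs ! k) $ y * A a (xs[k := y])))"
      unfolding sum_distrib_left[where A = "{..<n}"] by (rule sum.swap)
    also have "\<dots> = (\<Sum>k<n. if a = a' then \<kappa> * (\<Sum>x\<in>UNIV. X k $ x $ x) else 0)"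
      by (intro sum.cong refl leg) simp
    also have "\<dots> = (if a = a' then \<kappa> * \<tau> else 0)"
      by (simp add: \<tau>_def sum_distrib_left)
    finally have 2: "(\<Sum>xs\<in>physical_indices n. cnj (A a' xs) * (\<Sum>k<n. \<Sum>y\<in>UNIV. X k $ (xs ! k) $ y * A a (xs[k := y])))
      = (if a = a' then \<kappa> * \<tau> else 0)" .
    have "X0 $ a $ a' * D + (if a = a' then \<kappa> * \<tau> else 0)
      = (\<Sum>xs\<in>physical_indices n. cnj (A a' xs) * (\<mu> * A a xs))"
      unfolding 1[symmetric] 2[symmetric] sum.distrib[symmetric] distrib_left[symmetric]
      by (intro sum.cong refl) (simp add: eig)
    also have "\<dots> = \<mu> * (\<Sum>xs\<in>physical_indices n. cnj (A a' xs) * A a xs)"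
      by (simp add: sum_distrib_left mult_ac)
    also have "\<dots> = (if a = a' then \<mu> * D else 0)"
      by (simp add: gram)
    finally show ?thesis
      using D by (auto simp: field_simps split: if_splits)
  qed
  then show thesis by (rule that)
qed

section \<open>From the scalar generator to a phase\<close>

text \<open>Each entry solves the scalar equation y' = c y; the integrating factor exp(-s c) makes
  it constant.\<close>

lemma one_parameter_group_scalar_generator:
  fixes \<phi> :: "real \<Rightarrow> complex^'a^'a"
  assumes \<phi>': "\<And>t. (\<phi> has_vector_derivative X ** \<phi> t) (at t)" and "\<phi> 0 = mat 1"
    and X: "\<And>a b. X $ a $ b = (if a = b then c else 0)"
  shows "\<phi> t $ a $ b = (if a = b then exp (of_real t * c) else 0)"
proof -
  define D where "D s = exp (of_real (- s) * c) * \<phi> s $ a $ b" for s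
  have "(D has_vector_derivative 0) (at s)" for s
  proof -
    have "(X ** \<phi> s) $ a $ b = c * \<phi> s $ a $ b"
      by (simp add: matrix_matrix_mult_def X if_distrib if_distribR cong: if_cong)
    then have "((\<lambda>s. \<phi> s $ a $ b) has_vector_derivative c * \<phi> s $ a $ b) (at s)"
      using has_vector_derivative_matrix_component[OF \<phi>'[of s], of a b] by simp
    moreover have "((\<lambda>z. exp (- z * c)) has_field_derivative - c * exp (- of_real s * c)) (at (of_real s))"
      by (auto intro!: derivative_eq_intros)
    then have "((\<lambda>s. exp (of_real (- s) * c)) has_vector_derivative - c * exp (of_real (- s) * c)) (at s)"
      by (auto dest: has_vector_derivative_real_field)
    ultimately show ?thesis
      unfolding D_def[abs_def] by (auto dest: has_vector_derivative_mult)
  qed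
  then have "D t = D 0"
    using has_vector_derivative_zero_constant[of UNIV D] by (metis UNIV_I convex_UNIV)
  then have "exp (- (of_real t * c)) * \<phi> t $ a $ b = (if a = b then 1 else 0)"
    by (simp add: D_def assms(2) mat_def)
  then show ?thesis
    by (auto simp: exp_minus field_simps split: if_splits)
qed

lemma SU2_invariant_code_logical_phase:
  fixes A :: "('l::finite, 'd::finite) tensor"
    and R0 :: "complex^2^2 \<Rightarrow> complex^'l^'l" and R :: "nat \<Rightarrow> complex^2^2 \<Rightarrow> complex^'d^'d"
  assumes n: "n \<ge> 1" and code: "holographic_code_tensor n A"
    and R0: "continuous_SU2_rep R0" and R: "\<And>k. k < n \<Longrightarrow> continuous_SU2_rep (R k)"
    and inv: "SU2_invariant n R0 R A" and g: "g \<in> SU2"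
  obtains z where "cmod z = 1" "\<And>a b. R0 g $ a $ b = (if a = b then z else 0)"
proof -
  obtain J \<theta> where J: "J ** J = - mat 1" "range (su2_curve J) \<subseteq> SU2" and g_eq: "g = su2_curve J \<theta>"
    using SU2_imp_su2_curve[OF g] by blast
  let ?\<gamma> = "su2_curve J"
  have mem: "?\<gamma> t \<in> SU2" for t
    using J by blast
  \<comment> \<open>The type variable of \<open>Q\<close> is free, so one statement serves the
    logical and the physical legs.\<close>
  have rep: "(\<exists>X. \<forall>t. ((\<lambda>t. Q (?\<gamma> t)) has_vector_derivative X ** Q (?\<gamma> t)) (at t)) \<and> Q (?\<gamma> 0) = mat 1"
    if Q: "continuous_SU2_rep Q" for Q :: "complex^2^2 \<Rightarrow> complex^'a^'a"
  proof -
    have "continuous_on UNIV (\<lambda>t. Q (?\<gamma> t))"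
      using Q J by (intro continuous_on_compose2[OF _ continuous_on_su2_curve, of SU2 Q])
        (auto simp: continuous_SU2_rep_def)
    moreover have "Q (?\<gamma> 0) = mat 1"
      using Q by (simp add: continuous_SU2_rep_def)
    moreover have "Q (?\<gamma> (s + t)) = Q (?\<gamma> s) ** Q (?\<gamma> t)" for s t
      using Q mem by (simp add: continuous_SU2_rep_def su2_curve_add[OF J(1)])
    ultimately show ?thesis
      using continuous_one_parameter_group_differentiable[of "\<lambda>t. Q (?\<gamma> t)"] by metis
  qed
  \<comment> \<open>The equation for \<open>R0\<close> is kept at all times, since it is integrated
    later to reach \<open>g\<close>; for the physical legs the derivative at 0 suffices.\<close>
  obtain X0 where X0: "\<And>t. ((\<lambda>t. R0 (?\<gamma> t)) has_vector_derivative X0 ** R0 (?\<gamma> t)) (at t)"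
    and R0_0: "R0 (?\<gamma> 0) = mat 1"
    using rep[OF R0] by blast
  have "\<forall>k. \<exists>X. k < n \<longrightarrow> ((\<lambda>t. R k (?\<gamma> t)) has_vector_derivative X) (at 0)"
    using rep[OF R] by blast
  then obtain X where X: "\<And>k. k < n \<Longrightarrow> ((\<lambda>t. R k (?\<gamma> t)) has_vector_derivative X k) (at 0)"
    by metis
  have R_0: "R k (?\<gamma> 0) = mat 1" if "k < n" for k
    using rep[OF R[OF that]] by blast
  have X0_0: "((\<lambda>t. R0 (?\<gamma> t)) has_vector_derivative X0) (at 0)"
    using X0[of 0] R0_0 by simp
  define \<psi> where "\<psi> = tensor_state n A"
  define F where "F t i = (\<Sum>j\<in>joint_indices n. tensor_rep n R0 R (?\<gamma> t) i j * \<psi> j)" for t i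
  define F' where "F' = (\<lambda>(a, xs). (\<Sum>b\<in>UNIV. X0 $ a $ b * \<psi> (b, xs)) +
    (\<Sum>k<n. \<Sum>y\<in>UNIV. X k $ (xs ! k) $ y * \<psi> (a, xs[k := y])))"
  \<comment> \<open>Conjugating the projector of \<open>\<psi>\<close> by the tensor representation
    gives the projector of the transformed vector \<open>F t\<close>.\<close>
  have proj: "projector (F t) i j = projector \<psi> i j"
    if "i \<in> joint_indices n" "j \<in> joint_indices n" for t i j
  proof -
    have "projector \<psi> i j = kmult (joint_indices n)
          (kmult (joint_indices n) (tensor_rep n R0 R (?\<gamma> t)) (projector \<psi>))
          (kadj (tensor_rep n R0 R (?\<gamma> t))) i j"
      using inv that mem unfolding SU2_invariant_def \<psi>_def by simp
    also have "\<dots> = (\<Sum>l\<in>joint_indices n. F t i * (cnj (\<psi> l) * cnj (tensor_rep n R0 R (?\<gamma> t) j l)))"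
      unfolding kmult_def kadj_def projector_def F_def
      by (intro sum.cong refl) (simp add: sum_distrib_left sum_distrib_right mult_ac)
    also have "\<dots> = projector (F t) i j"
      by (simp add: projector_def F_def[of t j] sum_distrib_left mult_ac)
    finally show ?thesis by simp
  qed
  have F_0: "F 0 i = \<psi> i" if i: "i \<in> joint_indices n" for i
  proof -
    have "F 0 i = (\<Sum>j\<in>joint_indices n. if j = i then \<psi> j else 0)"
      unfolding F_def using i R0_0 R_0 by (intro sum.cong refl) (simp add: tensor_rep_identity)
    with i show ?thesis
      by (simp add: finite_joint_indices)
  qed
  have F_deriv: "((\<lambda>t. F t i) has_vector_derivative F' i) (at 0)" if "i \<in> joint_indices n" for i
  proof -
    obtain a xs where i: "i = (a, xs)" by fastforce
    show ?thesis
      using has_vector_derivative_tensor_rep[OF X0_0 R0_0 X R_0, where xs = xs and a = a and \<psi> = \<psi>] that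
      by (simp add: i F_def F'_def joint_indices_def)
  qed
  obtain \<mu> where \<mu>: "\<And>i. i \<in> joint_indices n \<Longrightarrow> F' i = \<mu> * \<psi> i"
    using projector_eq_imp_derivative_proportional[of "joint_indices n" F \<psi> F', OF proj F_0 F_deriv] by blast
  define r where "r = complex_of_real (sqrt (\<Sum>(b, ys)\<in>joint_indices n. (cmod (A b ys))\<^sup>2))"
  have \<psi>: "\<psi> (a, xs) = A a xs / r" for a xs
    by (simp add: \<psi>_def tensor_state_def r_def)
  \<comment> \<open>If the norm vanished, so would every entry of \<open>A\<close> and its Gram
    matrix, against \<open>\<kappa> \<noteq> 0\<close>. Thus \<open>r\<close> can be cancelled to
    pass from \<open>\<psi>\<close> to \<open>A\<close>.\<close>
  have "r \<noteq> 0"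
  proof
    assume "r = 0"
    then have "\<forall>i\<in>joint_indices n. (case i of (b, ys) \<Rightarrow> (cmod (A b ys))\<^sup>2) = 0"
      unfolding r_def by (subst sum_nonneg_eq_0_iff[symmetric]) (auto simp: finite_joint_indices)
    then have zero: "A b ys = 0" if "length ys = n" for b ys
      using that by (auto simp: joint_indices_def physical_indices_def)
    obtain \<kappa> where "\<kappa> \<noteq> 0" and \<kappa>: "\<And>k p q. k < n \<Longrightarrow>
      (\<Sum>ys\<in>physical_indices (n - 1). cnj (leg_map k A ys p) * leg_map k A ys q) = (if p = q then \<kappa> else 0)"
      using holographic_code_tensor_leg_orthogonality[OF code] by blast
    moreover have "(\<Sum>ys\<in>physical_indices (n - 1). cnj (leg_map 0 A ys p) * leg_map 0 A ys p) = 0" for p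
      using n by (intro sum.neutral) (auto simp: leg_map_def physical_indices_def zero split: prod.split)
    ultimately show False
      using n \<kappa>[of 0] by force
  qed
  have eig: "(\<Sum>b\<in>UNIV. X0 $ a $ b * A b xs) + (\<Sum>k<n. \<Sum>y\<in>UNIV. X k $ (xs ! k) $ y * A a (xs[k := y]))
      = \<mu> * A a xs" if "xs \<in> physical_indices n" for a xs
  proof -
    have "F' (a, xs) = \<mu> * \<psi> (a, xs)"
      using that by (intro \<mu>) (simp add: joint_indices_def)
    then have "((\<Sum>b\<in>UNIV. X0 $ a $ b * A b xs) + (\<Sum>k<n. \<Sum>y\<in>UNIV. X k $ (xs ! k) $ y * A a (xs[k := y]))) / r
      = \<mu> * A a xs / r"
      by (simp add: F'_def \<psi> sum_divide_distrib add_divide_distrib)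
    with \<open>r \<noteq> 0\<close> show ?thesis by simp
  qed
  obtain c where c: "\<And>a b. X0 $ a $ b = (if a = b then c else 0)"
    using logical_generator_scalar[OF code n eig] by blast
  have scalar: "R0 (?\<gamma> t) $ a $ b = (if a = b then exp (of_real t * c) else 0)" for t a b
    by (rule one_parameter_group_scalar_generator[OF X0 R0_0 c])
  \<comment> \<open>The curve closes up after \<open>2 * pi\<close>; \<open>undefined\<close> is
    just some diagonal index. Taking moduli gives \<open>Re c = 0\<close>, with no unitarity assumed
    of \<open>R0\<close>.\<close>
  have "exp (of_real (2 * pi) * c) = 1"
    using scalar[of "2 * pi" undefined undefined] R0_0 by (simp add: mat_def)
  then have "exp (2 * pi * Re c) = 1"
    using norm_exp_eq_Re[of "of_real (2 * pi) * c"] by simp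
  then have "Re c = 0"
    by simp
  then show thesis
    using scalar by (intro that[of "exp (of_real \<theta> * c)"]) (simp_all add: g_eq)
qed

theorem mainTheorem3:
  fixes n :: nat
  assumes "n \<ge> 1"
  shows "\<not> (\<exists>(A :: ('l::finite, 'd::finite) tensor)
              (R0 :: complex^2^2 \<Rightarrow> complex^'l^'l)
              (R :: nat \<Rightarrow> complex^2^2 \<Rightarrow> complex^'d^'d).
            holographic_code_tensor n A \<and>
            continuous_SU2_rep R0 \<and>
            (\<forall>k<n. continuous_SU2_rep (R k)) \<and>
            SU2_invariant n R0 R A \<and>
            nontrivial_adjoint_action R0)"
proof clarify
  fix A :: "('l, 'd) tensor" and R0 :: "complex^2^2 \<Rightarrow> complex^'l^'l"
    and R :: "nat \<Rightarrow> complex^2^2 \<Rightarrow> complex^'d^'d"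
  assume code: "holographic_code_tensor n A" and R0: "continuous_SU2_rep R0"
    and R: "\<forall>k<n. continuous_SU2_rep (R k)" and inv: "SU2_invariant n R0 R A"
    and nontriv: "nontrivial_adjoint_action R0"
  have "R0 g ** Y ** hconj (R0 g) = Y" if g: "g \<in> SU2" for g Y
  proof -
    obtain z where z: "cmod z = 1" "\<And>a b. R0 g $ a $ b = (if a = b then z else 0)"
      using SU2_invariant_code_logical_phase[OF assms code R0 R[rule_format] inv g] by blast
    have "z * cnj z = 1"
      using z(1) by (simp add: complex_norm_square[symmetric])
    then show ?thesis
      by (simp add: vec_eq_iff matrix_matrix_mult_def hconj_def z(2) if_distrib if_distribR cong: if_cong)
  qed
  then show False
    using nontriv by (simp add: nontrivial_adjoint_action_def)
qed

end
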